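(* Let $G=(V,E)$ be a digraph with energy $\mathcal{E}(G)$ and Randić index $R(G)$. Then $\mathcal{E}(G)=2R(G)$ if and only if there is a splitting of $G$ into sink-source digraphs $\{G_1,\dots,G_k\}$ such that, for each $i$, $G_i=\overrightarrow{K}_{n_i,m_i}$ (up to isomorphism) for some $n_i,m_i\in\mathbb{N}$.
   Context: A digraph is a pair $G=(V,E)$ with $V=\{v_1,\dots,v_n\}$ a finite set and $E\subset V\times V$ such that $(v,v)\notin E$ for all $v\in V$ (both $(v,w)$ and $(w,v)$ may belong to $E$). Its adjacency matrix $A$ is the $n\times n$ matrix with $A_{ij}=1$ if $(v_i,v_j)\in E$ and $A_{ij}=0$ otherwise. The energy of $G$ is $\mathcal{E}(G)=\mathrm{Tr}((AA^t)^{1/2})=\mathrm{Tr}((A^tA)^{1/2})$, i.e. the sum of the singular values of $A$ counted with multiplicity. For $v\in V$, the outer degree is $d^+(v)=d_G^+(v)=|\{w\in V:(v,w)\in E\}|$ and the inner degree is $d^-(v)=d_G^-(v)=|\{w\in V:(w,v)\in E\}|$. The Randić index of $G$ is $$R(G)=\frac{1}{2}\sum_{(v,w)\in E}\frac{1}{\sqrt{d^+(v)\,d^-(w)}}.$$ A vertex $v$ is a sink if $d^+(v)=0$ and a source if $d^-(v)=0$. A digraph is a sink-source digraph if each of its vertices is a sink or a source. A splitting of $G$ into sink-source digraphs is a set $\{G_1,\dots,G_k\}$ of sink-source digraphs $G_i=(V_i,E_i)$ such that $G=\bigcup_{i=1}^k G_i$ (that is, $V=\bigcup_i V_i$ and $E=\bigcup_i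 E_i$; the vertex sets $V_i$ need not be disjoint), with the condition that for every $i$ and every $v\in V_i$: $d^+_{G_i}(v)\neq 0$ implies $d^+_G(v)=d^+_{G_i}(v)$, and $d^-_{G_i}(v)\neq 0$ implies $d^-_G(v)=d^-_{G_i}(v)$. $\overrightarrow{K}_{n,m}$ denotes the complete bipartite graph $K_{n,m}$ with all edges oriented from the part of size $n$ to the part of size $m$: its vertex set is a disjoint union $X\sqcup Y$ with $|X|=n$, $|Y|=m$, and its edge set is $X\times Y$. Here $\mathbb{N}=\{0,1,2,\dots\}$, so that for instance $\overrightarrow{K}_{1,0}$ is a single isolated vertex. *)

theory Defs
  imports
    Complex_Main
    "Graph_Theory.Pair_Digraph"
    "Graph_Theory.Digraph_Isomorphism"
    "Jordan_Normal_Form.Matrix"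
begin

(* Digraphs in the sense used here (finite, no loops, no parallel arcs) are the models of the
   locale pair_digraph. *)

definition positive_semidefinite :: "real mat \<Rightarrow> bool" where
  "positive_semidefinite B \<longleftrightarrow>
     square_mat B \<and> transpose_mat B = B \<and>
     (\<forall>x \<in> carrier_vec (dim_row B). 0 \<le> x \<bullet> (B *\<^sub>v x))"

(* Meaningful for positive semidefinite M only: such an M has exactly one positive semidefinite
   square root. *)
definition psd_sqrt :: "real mat \<Rightarrow> real mat" where
  "psd_sqrt M = (THE B. positive_semidefinite B \<and> B * B = M)"

definition mat_trace :: "real mat \<Rightarrow> real" where
  "mat_trace B = sum_list (diag_mat B)"

(* Here and in the energy, the list vs = [v_1, ..., v_n] is a repetition-free enumeration of the
   vertex set. *)
definition adjacency_matrix :: "'a list \<Rightarrow> 'a pair_pre_digraph \<Rightarrow> real mat" where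
  "adjacency_matrix vs G =
     mat (length vs) (length vs) (\<lambda>(i, j). if (vs ! i, vs ! j) \<in> parcs G then 1 else 0)"

definition energy :: "'a list \<Rightarrow> 'a pair_pre_digraph \<Rightarrow> real" where
  "energy vs G =
     (let A = adjacency_matrix vs G in mat_trace (psd_sqrt (A * transpose_mat A)))"

definition randic_index :: "'a pair_pre_digraph \<Rightarrow> real" where
  "randic_index G =
     1 / 2 * (\<Sum>(v, w) \<in> parcs G. 1 / sqrt (real (out_degree (with_proj G) v) * real (in_degree (with_proj G) w)))"

definition is_sink :: "'a pair_pre_digraph \<Rightarrow> 'a \<Rightarrow> bool" where
  "is_sink G v \<longleftrightarrow> out_degree (with_proj G) v = 0"

definition is_source :: "'a pair_pre_digraph \<Rightarrow> 'a \<Rightarrow> bool" where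
  "is_source G v \<longleftrightarrow> in_degree (with_proj G) v = 0"

definition sink_source_digraph :: "'a pair_pre_digraph \<Rightarrow> bool" where
  "sink_source_digraph G \<longleftrightarrow>
     pair_digraph G \<and> (\<forall>v \<in> pverts G. is_sink G v \<or> is_source G v)"

definition sink_source_splitting ::
    "'a pair_pre_digraph \<Rightarrow> 'a pair_pre_digraph set \<Rightarrow> bool" where
  "sink_source_splitting G Hs \<longleftrightarrow>
     finite Hs \<and>
     (\<forall>H \<in> Hs. sink_source_digraph H) \<and>
     pverts G = (\<Union>H \<in> Hs. pverts H) \<and>
     parcs G = (\<Union>H \<in> Hs. parcs H) \<and>
     (\<forall>H \<in> Hs. \<forall>v \<in> pverts H.
        (out_degree (with_proj H) v \<noteq> 0 \<longrightarrow> out_degree (with_proj G) v = out_degree (with_proj H) v) \<and>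
        (in_degree (with_proj H) v \<noteq> 0 \<longrightarrow> in_degree (with_proj G) v = in_degree (with_proj H) v))"

definition oriented_complete_bipartite :: "nat \<Rightarrow> nat \<Rightarrow> (nat + nat) pair_pre_digraph" where
  "oriented_complete_bipartite n m =
     \<lparr> pverts = {..<n} <+> {..<m}, parcs = Inl ` {..<n} \<times> Inr ` {..<m} \<rparr>"

end

(* Let A be the adjacency matrix and N the matrix with entries A_vw / sqrt (d+(v) d-(w)).
   By Cauchy-Schwarz N is a contraction, and 2 R(G) = Tr (N A^t).  Writing S for the square root
   of A A^t, contractivity gives |N A^t x| <= |S x| for all x, so Tr (N A^t) = Tr S forces
   N A^t = S.  The diagonal of S^2 = A A^t then yields equality in

     (N A^t)_vu^2 <= (c(v,u) / d+(v)) * (sum_w A_vw A_uw / d-(w)),   c(v,u) = sum_w A_vw A_uw,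

   after bounding c(v,u) <= d+(v) and summing over u.  Hence two vertices with a common
   out-neighbor have the same out-neighborhood, i.e. the arc relation is difunctional.
   Conversely, for a difunctional relation N A^t N = A and N A^t is positive semidefinite, so
   N A^t is the square root of A A^t.  Finally, a digraph is difunctional iff the products
   (in-neighbors of w) x (out-neighbors of v), for arcs (v,w), form a splitting of it. *)
theory Submission
  imports
    Defs
    "Jordan_Normal_Form.Char_Poly"
    "HOL-Computational_Algebra.Fundamental_Theorem_Algebra"
    "HOL-Analysis.Convex"
begin

unbundle no inner_syntax

section \<open>Diagonalization of real symmetric matrices\<close>

text \<open>The entries are a function on all of \<open>nat\<close>, so that the induction for
  diagonalization can prepend an eigenvalue with \<open>case_nat\<close>.\<close>

definition diagonal :: "nat \<Rightarrow> (nat \<Rightarrow> real) \<Rightarrow> real mat" where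
  "diagonal n d = mat n n (\<lambda>(i, j). if i = j then d i else 0)"

lemma diagonal_carrier [simp]: "diagonal n d \<in> carrier_mat n n"
  by (simp add: diagonal_def)

lemma index_mat_mult_sum:
  assumes "A \<in> carrier_mat n m" "B \<in> carrier_mat m k" "i < n" "j < k"
  shows "(A * B) $$ (i, j) = (\<Sum>l<m. A $$ (i, l) * B $$ (l, j))"
  using assms by (auto simp: scalar_prod_def lessThan_atLeast0 intro!: sum.cong)

lemma scalar_prod_self_nonneg: "0 \<le> v \<bullet> (v :: real vec)"
  by (simp add: scalar_prod_def sum_nonneg)

lemma scalar_prod_self_eq_0:
  fixes v :: "real vec"
  assumes "v \<in> carrier_vec n" "v \<bullet> v = 0"
  shows "v = 0\<^sub>v n"
proof (rule eq_vecI)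
  show "dim_vec v = dim_vec (0\<^sub>v n :: real vec)" using assms by simp
  fix i assume "i < dim_vec (0\<^sub>v n :: real vec)"
  then show "v $ i = 0\<^sub>v n $ i"
    using assms by (auto simp: scalar_prod_def sum_nonneg_eq_0_iff)
qed

text \<open>The fundamental theorem of algebra supplies a complex eigenvalue of the complexified
  matrix. Symmetry makes its Hermitian form real-valued, so the eigenvalue is real.\<close>

lemma real_symmetric_eigenvector:
  fixes A :: "real mat"
  assumes A: "A \<in> carrier_mat n n" and sym: "transpose_mat A = A" and n: "0 < n"
  obtains v e where "v \<in> carrier_vec n" "v \<bullet> v = 1" "A *\<^sub>v v = e \<cdot>\<^sub>v v"
proof -
  let ?C = "map_mat complex_of_real A"
  have C: "?C \<in> carrier_mat n n" using A by simp
  have "\<not> constant (poly (char_poly ?C))"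
    using degree_monic_char_poly[OF C] n by (simp add: constant_degree)
  then obtain k where k: "poly (char_poly ?C) k = 0"
    using fundamental_theorem_of_algebra by blast
  then obtain x where x: "x \<in> carrier_vec n" "x \<noteq> 0\<^sub>v n" "?C *\<^sub>v x = k \<cdot>\<^sub>v x"
    using eigenvalue_root_char_poly[OF C] C unfolding eigenvalue_def eigenvector_def by auto
  have Cx: "(\<Sum>j<n. of_real (A $$ (i,j)) * x $ j) = k * x $ i" if "i < n" for i
  proof -
    have "(?C *\<^sub>v x) $ i = (k \<cdot>\<^sub>v x) $ i" using x by simp
    then show ?thesis using that A x(1)
      by (auto simp: scalar_prod_def lessThan_atLeast0)
  qed
  have As: "A $$ (i,j) = A $$ (j,i)" if "i < n" "j < n" for i j
    using sym A that by (metis carrier_matD index_transpose_mat(1))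
  \<comment> \<open>The Hermitian form at \<open>x\<close> is computed in two ways: the eigenvalue
    equation gives \<open>k\<close> times the squared norm \<open>s\<close>, and swapping the two
    sums shows that it equals its own conjugate.\<close>
  define q where "q = (\<Sum>i<n. \<Sum>j<n. cnj (x $ i) * of_real (A $$ (i,j)) * x $ j)"
  define s where "s = (\<Sum>i<n. (cmod (x $ i))\<^sup>2)"
  have "q = (\<Sum>i<n. cnj (x $ i) * (k * x $ i))"
    unfolding q_def by (auto intro!: sum.cong simp: Cx[symmetric] sum_distrib_left mult_ac)
  also have "\<dots> = k * of_real s"
    unfolding s_def of_real_sum sum_distrib_left
    by (rule sum.cong[OF refl], subst complex_norm_square) (simp add: mult_ac)
  finally have q: "q = k * of_real s" .
  have "cnj q = (\<Sum>i<n. \<Sum>j<n. x $ i * of_real (A $$ (i,j)) * cnj (x $ j))"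
    by (simp add: q_def)
  also have "\<dots> = (\<Sum>j<n. \<Sum>i<n. x $ i * of_real (A $$ (i,j)) * cnj (x $ j))"
    by (rule sum.swap)
  also have "\<dots> = q"
    unfolding q_def by (intro sum.cong refl) (auto simp: As mult_ac)
  finally have qr: "cnj q = q" .
  have "s \<noteq> 0"
  proof
    assume "s = 0"
    then have "x = 0\<^sub>v n"
      using x unfolding s_def by (intro eq_vecI) (auto simp: sum_nonneg_eq_0_iff)
    with x show False by simp
  qed
  with q qr have "cnj k = k" by simp
  then obtain e where e: "k = of_real e" by (metis Reals_cases Reals_cnj_iff)
  \<comment> \<open>The vector \<open>x\<close> may be genuinely complex. Only the eigenvalue is
    carried back: it is a root of the characteristic polynomial over the reals, which provides a new
    eigenvector with real entries.\<close>
  have "char_poly ?C = map_poly of_real (char_poly A)"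
    by (rule of_real_hom.char_poly_hom[OF A])
  with k e have "poly (char_poly A) e = 0" by (simp add: of_real_hom.poly_map_poly)
  then obtain v where v: "v \<in> carrier_vec n" "v \<noteq> 0\<^sub>v n" "A *\<^sub>v v = e \<cdot>\<^sub>v v"
    using eigenvalue_root_char_poly[OF A] A unfolding eigenvalue_def eigenvector_def by auto
  have pos: "0 < v \<bullet> v"
    using scalar_prod_self_nonneg[of v] scalar_prod_self_eq_0[OF v(1)] v(2) by fastforce
  define c where "c = 1 / sqrt (v \<bullet> v)"
  show thesis
  proof
    show "c \<cdot>\<^sub>v v \<in> carrier_vec n" using v by simp
    show "(c \<cdot>\<^sub>v v) \<bullet> (c \<cdot>\<^sub>v v) = 1" using pos by (simp add: c_def flip: power2_eq_square)
    show "A *\<^sub>v (c \<cdot>\<^sub>v v) = e \<cdot>\<^sub>v (c \<cdot>\<^sub>v v)"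
      using A v by (simp add: mult_mat_vec smult_smult_assoc mult.commute)
  qed
qed

text \<open>For \<open>u = 0\<close> the quotient is \<open>2 / 0 = 0\<close> and the matrix is the identity, so no case distinction
  is needed for \<open>v\<close> equal to the first unit vector in \<open>col_0_householder\<close>.\<close>

definition householder :: "nat \<Rightarrow> real vec \<Rightarrow> real mat" where
  "householder n u = mat n n (\<lambda>(i, j). (if i = j then 1 else 0) - 2 / (u \<bullet> u) * (u $ i * u $ j))"

lemma householder_carrier [simp]: "householder n u \<in> carrier_mat n n"
  by (simp add: householder_def)

lemma householder_symmetric: "transpose_mat (householder n u) = householder n u"
  by (rule eq_matI) (auto simp: householder_def)

lemma householder_involution:
  assumes u: "u \<in> carrier_vec n"
  shows "householder n u * householder n u = 1\<^sub>m n"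
proof (rule eq_matI)
  fix i j assume "i < dim_row (1\<^sub>m n :: real mat)" "j < dim_col (1\<^sub>m n :: real mat)"
  then have ij: "i < n" "j < n" by auto
  define k where "k = 2 / (u \<bullet> u)"
  define \<delta> :: "nat \<Rightarrow> nat \<Rightarrow> real" where "\<delta> i j = (if i = j then 1 else 0)" for i j
  have uu: "u \<bullet> u = (\<Sum>l<n. u $ l * u $ l)"
    using u by (auto simp: scalar_prod_def lessThan_atLeast0)
  \<comment> \<open>This identity drives the cancellation. It also covers
    \<open>u \<bullet> u = 0\<close>, where division by zero gives \<open>k = 0\<close>.\<close>
  have kk: "k * k * (u \<bullet> u) = 2 * k" by (simp add: k_def)
  have "(householder n u * householder n u) $$ (i, j)
      = (\<Sum>l<n. (\<delta> i l - k * (u $ i * u $ l)) * (\<delta> l j - k * (u $ l * u $ j)))"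
    using ij by (subst index_mat_mult_sum[of _ n n _ n])
      (auto simp: householder_def k_def \<delta>_def intro!: sum.cong)
  also have "\<dots> = (\<Sum>l<n. \<delta> i l * \<delta> l j) - k * u $ j * (\<Sum>l<n. \<delta> i l * u $ l)
      - k * u $ i * (\<Sum>l<n. \<delta> l j * u $ l) + k * k * u $ i * u $ j * (\<Sum>l<n. u $ l * u $ l)"
    by (simp add: sum_distrib_left sum_subtractf sum.distrib algebra_simps)
  also have "\<dots> = \<delta> i j - 2 * k * u $ i * u $ j + k * k * (u \<bullet> u) * u $ i * u $ j"
    using ij by (simp add: \<delta>_def uu if_distrib[of "\<lambda>x. x * _"] sum.delta sum.delta' cong: if_cong)
  also have "\<dots> = \<delta> i j" by (simp add: kk)
  finally show "(householder n u * householder n u) $$ (i, j) = 1\<^sub>m n $$ (i, j)"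
    using ij by (simp add: \<delta>_def)
qed (use carrier_matD[OF householder_carrier] in simp_all)

text \<open>Reflection in the hyperplane orthogonal to the difference of two unit vectors exchanges
  them, so the first unit vector is sent to \<open>v\<close>.\<close>

lemma col_0_householder:
  assumes v: "v \<in> carrier_vec n" "v \<bullet> v = 1" and n: "0 < n"
  shows "col (householder n (v - unit_vec n 0)) 0 = v"
proof (rule eq_vecI)
  let ?u = "v - unit_vec n 0"
  fix i assume "i < dim_vec v"
  then have i: "i < n" using v by simp
  have "?u \<bullet> ?u = (\<Sum>l<n. (v $ l - (if l = 0 then 1 else 0)) * (v $ l - (if l = 0 then 1 else 0)))"
    using v by (auto simp: scalar_prod_def lessThan_atLeast0 unit_vec_def intro!: sum.cong)
  also have "\<dots> = (\<Sum>l<n. v $ l * v $ l - 2 * ((if l = 0 then 1 else 0) * v $ l) + (if l = 0 then 1 else 0))"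
    by (intro sum.cong) (auto simp: algebra_simps)
  also have "\<dots> = (\<Sum>l<n. v $ l * v $ l) - 2 * (\<Sum>l<n. (if l = 0 then 1 else 0) * v $ l)
      + (\<Sum>l<n. (if l = 0 then 1 else 0))"
    by (simp add: sum_distrib_left sum_subtractf sum.distrib)
  also have "\<dots> = v \<bullet> v - 2 * v $ 0 + 1"
    using n v by (simp add: scalar_prod_def lessThan_atLeast0 if_distrib[of "\<lambda>x. x * _"] cong: if_cong)
  finally have uu: "?u \<bullet> ?u = 2 - 2 * v $ 0" using v by simp
  have *: "col (householder n ?u) 0 $ i
    = (if i = 0 then 1 else 0) - 2 / (?u \<bullet> ?u) * ((v $ i - (if i = 0 then 1 else 0)) * (v $ 0 - 1))"
    using i n v by (auto simp: householder_def unit_vec_def)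
  show "col (householder n ?u) 0 $ i = v $ i"
  \<comment> \<open>By \<open>uu\<close> this is exactly the case of a vanishing \<open>?u\<close>,
    where \<open>v\<close> is the first unit vector. Otherwise \<open>uu\<close> cancels against the
    factor \<open>v $ 0 - 1\<close>.\<close>
  proof (cases "v $ 0 = 1")
    case True
    then have "?u = 0\<^sub>v n"
      using uu v by (intro scalar_prod_self_eq_0) auto
    then have "?u $ i = 0" using i by simp
    then show ?thesis unfolding * uu using True i v by (auto simp: unit_vec_def split: if_splits)
  next
    case False
    then show ?thesis unfolding * uu by (simp add: field_simps)
  qed
qed (use v in \<open>auto simp: householder_def\<close>)

text \<open>Deflation, by induction on the size. Conjugation with a reflection \<open>W\<close>
  whose first column is a unit eigenvector clears the first column below the diagonal, symmetry
  clears the first row, and the remaining block is again symmetric.\<close>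

theorem real_symmetric_diagonalization:
  fixes A :: "real mat"
  assumes "A \<in> carrier_mat n n" "transpose_mat A = A"
  shows "\<exists>U d. U \<in> carrier_mat n n \<and> transpose_mat U * U = 1\<^sub>m n \<and> A * U = U * diagonal n d"
  using assms
proof (induction n arbitrary: A)
  case 0
  then show ?case by (intro exI[of _ A] exI) (auto simp: diagonal_def intro!: eq_matI)
next
  case (Suc n A)
  note A = Suc.prems(1)
  obtain v e where v: "v \<in> carrier_vec (Suc n)" "v \<bullet> v = 1" "A *\<^sub>v v = e \<cdot>\<^sub>v v"
    using real_symmetric_eigenvector[OF Suc.prems] by blast
  define W where "W = householder (Suc n) (v - unit_vec (Suc n) 0)"
  have W: "W \<in> carrier_mat (Suc n) (Suc n)" by (simp add: W_def)
  have Wt: "transpose_mat W = W" by (simp add: W_def householder_symmetric)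
  have WW: "W * W = 1\<^sub>m (Suc n)" using v unfolding W_def by (intro householder_involution) auto
  have W0: "col W 0 = v" unfolding W_def by (rule col_0_householder) (use v in auto)
  define B where "B = W * (A * W)"
  have B: "B \<in> carrier_mat (Suc n) (Suc n)" using W A by (simp add: B_def)
  have Bt: "transpose_mat B = B"
    using W A by (simp add: B_def transpose_mult[of _ "Suc n" "Suc n" _ "Suc n"] Wt Suc.prems(2)
        assoc_mult_mat[of _ "Suc n" "Suc n" _ "Suc n" _ "Suc n"])
  have "col B 0 = W *\<^sub>v (A *\<^sub>v col W 0)"
    using W A by (simp add: B_def col_mult2[of _ "Suc n" "Suc n" _ "Suc n"])
  also have "\<dots> = e \<cdot>\<^sub>v (W *\<^sub>v col W 0)" using W v by (simp add: W0 mult_mat_vec)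
  also have "W *\<^sub>v col W 0 = col (W * W) 0"
    using W by (simp add: col_mult2[of _ "Suc n" "Suc n" _ "Suc n"])
  finally have B0: "col B 0 = e \<cdot>\<^sub>v unit_vec (Suc n) 0" by (simp add: WW)
  have Bi0: "B $$ (i, 0) = (if i = 0 then e else 0)" if "i < Suc n" for i
  proof -
    have "B $$ (i, 0) = col B 0 $ i" using B that by simp
    then show ?thesis using that by (simp add: B0)
  qed
  have B0i: "B $$ (0, i) = (if i = 0 then e else 0)" if "i < Suc n" for i
    using Bi0[OF that] Bt B that by (metis carrier_matD index_transpose_mat(1) zero_less_Suc)
  define A' where "A' = mat n n (\<lambda>(i, j). B $$ (Suc i, Suc j))"
  have A': "A' \<in> carrier_mat n n" by (simp add: A'_def)
  have "transpose_mat A' = A'"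
  proof (rule eq_matI)
    fix i j assume "i < dim_row A'" "j < dim_col A'"
    then have "i < n" "j < n" using A' by auto
    then have "B $$ (Suc j, Suc i) = B $$ (Suc i, Suc j)"
      using Bt B by (metis carrier_matD index_transpose_mat(1) Suc_less_eq)
    with \<open>i < n\<close> \<open>j < n\<close> show "transpose_mat A' $$ (i, j) = A' $$ (i, j)"
      by (simp add: A'_def)
  qed (use A' in auto)
  from Suc.IH[OF A' this] obtain U' d' where U': "U' \<in> carrier_mat n n"
    "transpose_mat U' * U' = 1\<^sub>m n" "A' * U' = U' * diagonal n d'" by blast
  define d where "d = case_nat e d'"
  \<comment> \<open>\<open>U0\<close> fixes the first unit vector, which \<open>W\<close> sends to
    \<open>v\<close>, and diagonalizes the remaining block. The required matrix is therefore
    \<open>W * U0\<close>.\<close>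
  define U0 where "U0 = four_block_mat (1\<^sub>m (Suc 0)) (0\<^sub>m (Suc 0) n) (0\<^sub>m n (Suc 0)) U'"
  have U0: "U0 \<in> carrier_mat (Suc n) (Suc n)" using four_block_carrier_mat[of "1\<^sub>m (Suc 0)" "Suc 0" "Suc 0" U' n n] U' by (simp add: U0_def)
  have Bb: "B = four_block_mat (e \<cdot>\<^sub>m 1\<^sub>m (Suc 0)) (0\<^sub>m (Suc 0) n) (0\<^sub>m n (Suc 0)) A'"
  proof (rule eq_matI)
    fix i j assume "i < dim_row (four_block_mat (e \<cdot>\<^sub>m 1\<^sub>m (Suc 0)) (0\<^sub>m (Suc 0) n) (0\<^sub>m n (Suc 0)) A')"
      "j < dim_col (four_block_mat (e \<cdot>\<^sub>m 1\<^sub>m (Suc 0)) (0\<^sub>m (Suc 0) n) (0\<^sub>m n (Suc 0)) A')"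
    then have "i < Suc n" "j < Suc n" using A' by auto
    then show "B $$ (i, j) = four_block_mat (e \<cdot>\<^sub>m 1\<^sub>m (Suc 0)) (0\<^sub>m (Suc 0) n) (0\<^sub>m n (Suc 0)) A' $$ (i, j)"
      using Bi0[of i] B0i[of j] A' by (cases i; cases j) (auto simp: A'_def)
  qed (use A' B in auto)
  have Db: "diagonal (Suc n) d = four_block_mat (e \<cdot>\<^sub>m 1\<^sub>m (Suc 0)) (0\<^sub>m (Suc 0) n) (0\<^sub>m n (Suc 0)) (diagonal n d')"
    by (intro eq_matI) (auto simp: diagonal_def d_def split: nat.splits)
  note block = mult_four_block_mat[of _ "Suc 0" "Suc 0" _ n _ n _ _ "Suc 0" _ n]
  have "transpose_mat U0 = four_block_mat (1\<^sub>m (Suc 0)) (0\<^sub>m (Suc 0) n) (0\<^sub>m n (Suc 0)) (transpose_mat U')"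
    unfolding U0_def using U' by (subst transpose_four_block_mat[of _ "Suc 0" "Suc 0" _ n _ n]) auto
  then have "transpose_mat U0 * U0
      = four_block_mat (1\<^sub>m (Suc 0)) (0\<^sub>m (Suc 0) n) (0\<^sub>m n (Suc 0)) (transpose_mat U' * U')"
    unfolding U0_def using U'(1) by (simp only:, subst block) auto
  also have "\<dots> = 1\<^sub>m (Suc n)" unfolding U'(2) by (intro eq_matI) auto
  finally have U0U0: "transpose_mat U0 * U0 = 1\<^sub>m (Suc n)" .
  have "B * U0 = four_block_mat (e \<cdot>\<^sub>m 1\<^sub>m (Suc 0)) (0\<^sub>m (Suc 0) n) (0\<^sub>m n (Suc 0)) (A' * U')"
    unfolding U0_def Bb using U'(1) A' by (subst block) auto
  also have "\<dots> = U0 * diagonal (Suc n) d"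
    unfolding U0_def Db U'(3) using U'(1) left_mult_zero_mat[OF diagonal_carrier, of "Suc 0" n d'] by (subst block) auto
  finally have BU0: "B * U0 = U0 * diagonal (Suc n) d" .
  note c = assoc_mult_mat[of _ "Suc n" "Suc n" _ "Suc n" _ "Suc n"]
  have "transpose_mat (W * U0) * (W * U0) = transpose_mat U0 * ((W * W) * U0)"
    using W U0 by (simp add: transpose_mult[of _ "Suc n" "Suc n" _ "Suc n"] Wt c)
  then have 1: "transpose_mat (W * U0) * (W * U0) = 1\<^sub>m (Suc n)"
    using U0 by (simp add: WW U0U0)
  have "A * (W * U0) = (W * W) * (A * (W * U0))" using W A U0 by (simp add: WW)
  also have "\<dots> = W * (B * U0)" using W A U0 by (simp add: B_def c)
  also have "\<dots> = (W * U0) * diagonal (Suc n) d" using W U0 by (simp add: BU0 c)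
  finally have 2: "A * (W * U0) = (W * U0) * diagonal (Suc n) d" .
  have "W * U0 \<in> carrier_mat (Suc n) (Suc n)" using W U0 by simp
  with 1 2 show ?case by blast
qed

section \<open>Positive semidefinite square roots and traces\<close>

lemma scalar_prod_diff_self:
  fixes a b :: "real vec"
  assumes "a \<in> carrier_vec n" "b \<in> carrier_vec n"
  shows "(a - b) \<bullet> (a - b) = a \<bullet> a - 2 * (b \<bullet> a) + b \<bullet> b"
proof -
  have "(a - b) \<bullet> (a - b) = (\<Sum>i<n. a $ i * a $ i - 2 * (b $ i * a $ i) + b $ i * b $ i)"
    using assms by (auto simp: scalar_prod_def lessThan_atLeast0 algebra_simps intro!: sum.cong)
  also have "\<dots> = a \<bullet> a - 2 * (b \<bullet> a) + b \<bullet> b"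
    using assms by (simp add: scalar_prod_def lessThan_atLeast0 sum.distrib sum_subtractf sum_distrib_left)
  finally show ?thesis .
qed

lemma scalar_prod_symmetric_mat:
  fixes A :: "real mat"
  assumes "A \<in> carrier_mat n n" "transpose_mat A = A" "x \<in> carrier_vec n" "y \<in> carrier_vec n"
  shows "(A *\<^sub>v x) \<bullet> y = x \<bullet> (A *\<^sub>v y)"
  using transpose_vec_mult_scalar[OF assms(1,4,3)] assms by (simp add: comm_scalar_prod[of _ n])

text \<open>The diagonalization in two forms: a factorization, from which square roots are built,
  and an orthonormal basis of eigenvectors, on which matrices and traces are compared.\<close>

lemma symmetric_eigenbasis:
  fixes A :: "real mat"
  assumes A: "A \<in> carrier_mat n n" "transpose_mat A = A"
  obtains U d where "U \<in> carrier_mat n n" "transpose_mat U * U = 1\<^sub>m n" "U * transpose_mat U = 1\<^sub>m n"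
    "A = U * diagonal n d * transpose_mat U"
    "\<And>i. i < n \<Longrightarrow> A *\<^sub>v col U i = d i \<cdot>\<^sub>v col U i"
    "\<And>i. i < n \<Longrightarrow> col U i \<bullet> col U i = 1"
proof -
  obtain U d where U: "U \<in> carrier_mat n n" "transpose_mat U * U = 1\<^sub>m n"
    "A * U = U * diagonal n d" using real_symmetric_diagonalization[OF assms] by blast
  have UU: "U * transpose_mat U = 1\<^sub>m n"
    using mat_mult_left_right_inverse[OF _ U(1) U(2)] U by simp
  have "A = A * (U * transpose_mat U)" using A by (simp add: UU)
  also have "\<dots> = A * U * transpose_mat U"
    using assoc_mult_mat[OF A(1) U(1), of "transpose_mat U" n] U by simp
  finally have Ad: "A = U * diagonal n d * transpose_mat U" by (simp add: U)
  have ev: "A *\<^sub>v col U i = d i \<cdot>\<^sub>v col U i" if i: "i < n" for i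
  proof -
    have "A *\<^sub>v col U i = col (U * diagonal n d) i"
      using col_mult2[OF A(1) U(1) i] U(3) by simp
    also have "\<dots> = d i \<cdot>\<^sub>v col U i"
    proof (rule eq_vecI)
      fix j assume "j < dim_vec (d i \<cdot>\<^sub>v col U i)"
      then have j: "j < n" using U by simp
      have "col (U * diagonal n d) i $ j = (U * diagonal n d) $$ (j, i)"
        using U(1) i j carrier_matD[OF diagonal_carrier[of n d]] by simp
      also have "\<dots> = (\<Sum>l<n. U $$ (j, l) * diagonal n d $$ (l, i))"
        using U i j by (intro index_mat_mult_sum) auto
      also have "\<dots> = U $$ (j, i) * d i"
        using i by (simp add: diagonal_def if_distrib[of "\<lambda>x. _ * x"] cong: if_cong)
      finally show "col (U * diagonal n d) i $ j = (d i \<cdot>\<^sub>v col U i) $ j"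
        using U i j by simp
    qed (use U in auto)
    finally show ?thesis .
  qed
  have "col U i \<bullet> col U i = 1" if i: "i < n" for i
  proof -
    have "(transpose_mat U * U) $$ (i, i) = col U i \<bullet> col U i" using U(1) i by simp
    then show ?thesis unfolding U(2) using i by simp
  qed
  with U UU Ad ev show ?thesis using that by blast
qed

lemma mat_eq_on_orthonormal_basis:
  fixes A B :: "real mat"
  assumes "A \<in> carrier_mat n n" "B \<in> carrier_mat n n" "U \<in> carrier_mat n n" "U * transpose_mat U = 1\<^sub>m n"
    and "\<And>i. i < n \<Longrightarrow> A *\<^sub>v col U i = B *\<^sub>v col U i"
  shows "A = B"
proof -
  have "A * U = B * U"
  proof (rule mat_col_eqI)
    fix i assume "i < dim_col (B * U)"
    then have "i < n" using assms by simp
    then show "col (A * U) i = col (B * U) i"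
      using assms by (simp only: col_mult2[of _ n n U n])
  qed (use assms in auto)
  then have "(A * U) * transpose_mat U = (B * U) * transpose_mat U" by simp
  moreover have "(A * U) * transpose_mat U = A" "(B * U) * transpose_mat U = B"
    using assoc_mult_mat[of _ n n U n "transpose_mat U" n] assms by auto
  ultimately show ?thesis by simp
qed

section \<open>Positive semidefinite matrices, Gram matrices and square roots\<close>

lemma positive_semidefiniteD:
  assumes "positive_semidefinite B" "B \<in> carrier_mat n n"
  shows "transpose_mat B = B" "x \<in> carrier_vec n \<Longrightarrow> 0 \<le> x \<bullet> (B *\<^sub>v x)"
  using assms by (auto simp: positive_semidefinite_def)

lemma scalar_prod_gram:
  fixes A :: "real mat"
  assumes A: "A \<in> carrier_mat n m" and x: "x \<in> carrier_vec n"
  shows "x \<bullet> ((A * transpose_mat A) *\<^sub>v x) = (transpose_mat A *\<^sub>v x) \<bullet> (transpose_mat A *\<^sub>v x)"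
  using transpose_vec_mult_scalar[OF A, of "transpose_mat A *\<^sub>v x" x] A x by simp

lemma positive_semidefinite_gram:
  fixes A :: "real mat"
  assumes A: "A \<in> carrier_mat n m"
  shows "positive_semidefinite (A * transpose_mat A)"
  unfolding positive_semidefinite_def
proof (intro conjI ballI)
  show "transpose_mat (A * transpose_mat A) = A * transpose_mat A"
    using transpose_mult[OF A, of "transpose_mat A" n] A by simp
  fix x :: "real vec" assume "x \<in> carrier_vec (dim_row (A * transpose_mat A))"
  then have x: "x \<in> carrier_vec n" using A by simp
  show "0 \<le> x \<bullet> ((A * transpose_mat A) *\<^sub>v x)"
    by (simp only: scalar_prod_gram[OF A x] scalar_prod_self_nonneg)
qed (use A in simp)

lemma positive_semidefinite_eigenvalue_nonneg:
  assumes "positive_semidefinite B" "B \<in> carrier_mat n n" "p \<in> carrier_vec n" "p \<bullet> p = 1"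
    and "B *\<^sub>v p = s \<cdot>\<^sub>v p"
  shows "0 \<le> s"
  using positive_semidefiniteD(2)[OF assms(1,2,3)] assms(3-) by simp

lemma diagonal_mult: "diagonal n d * diagonal n e = diagonal n (\<lambda>i. d i * e i)"
proof (rule eq_matI)
  fix i j assume "i < dim_row (diagonal n (\<lambda>i. d i * e i))" "j < dim_col (diagonal n (\<lambda>i. d i * e i))"
  then have "i < n" "j < n" by (simp_all add: diagonal_def)
  then show "(diagonal n d * diagonal n e) $$ (i, j) = diagonal n (\<lambda>i. d i * e i) $$ (i, j)"
    by (subst index_mat_mult_sum[of _ n n _ n])
      (auto simp: diagonal_def if_distrib[of "\<lambda>x. x * _"] cong: if_cong)
qed (simp_all add: diagonal_def)

lemma transpose_diagonal [simp]: "transpose_mat (diagonal n d) = diagonal n d"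
  by (rule eq_matI) (auto simp: diagonal_def)

text \<open>Replacing the eigenvalues by their square roots gives a root \<open>B\<close>. Fourth
  roots of the eigenvalues exhibit \<open>B\<close> as the Gram matrix of \<open>U * F\<close>,
  which makes it positive semidefinite.\<close>

lemma positive_semidefinite_sqrt_exists:
  assumes psd: "positive_semidefinite M" and M: "M \<in> carrier_mat n n"
  shows "\<exists>B. positive_semidefinite B \<and> B * B = M"
proof -
  obtain U d where U: "U \<in> carrier_mat n n" "transpose_mat U * U = 1\<^sub>m n"
    and Md: "M = U * diagonal n d * transpose_mat U"
    and ev: "\<And>i. i < n \<Longrightarrow> M *\<^sub>v col U i = d i \<cdot>\<^sub>v col U i"
    and unit: "\<And>i. i < n \<Longrightarrow> col U i \<bullet> col U i = 1"
    using symmetric_eigenbasis[OF M] positive_semidefiniteD(1)[OF psd M] by metis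
  have nonneg: "0 \<le> d i" if "i < n" for i
    by (rule positive_semidefinite_eigenvalue_nonneg[OF psd M _ unit ev]) (use U that in auto)
  define R where "R = diagonal n (\<lambda>i. sqrt (d i))"
  define F where "F = diagonal n (\<lambda>i. sqrt (sqrt (d i)))"
  have R: "R \<in> carrier_mat n n" and F: "F \<in> carrier_mat n n" by (simp_all add: R_def F_def)
  have FF: "F * F = R" and RR: "R * R = diagonal n d"
    using nonneg by (auto simp: R_def F_def diagonal_mult) (auto simp: diagonal_def intro!: eq_matI)
  note c = assoc_mult_mat[of _ n n _ n _ n]
  define B where "B = U * (R * transpose_mat U)"
  have "B = (U * F) * transpose_mat (U * F)"
    using U F by (simp add: B_def FF[symmetric] transpose_mult[of _ n n _ n] c) (simp add: F_def)
  then have "positive_semidefinite B"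
    using positive_semidefinite_gram[of "U * F" n n] U F by simp
  moreover have "B * B = U * (R * ((transpose_mat U * U) * (R * transpose_mat U)))"
    using U(1) R by (simp add: B_def c)
  then have "B * B = M" using U R by (simp add: Md RR[symmetric] c)
  ultimately show ?thesis by blast
qed

text \<open>The vector \<open>y = B *\<^sub>v p - s \<cdot>\<^sub>v p\<close> is mapped by
  \<open>B\<close> to \<open>- s\<close> times itself. For \<open>s > 0\<close> semidefiniteness
  leaves only \<open>y = 0\<close>; for \<open>s = 0\<close> the squared norm of
  \<open>B *\<^sub>v p\<close> is the quadratic form of \<open>B * B\<close> at \<open>p\<close>,
  which vanishes.\<close>

lemma eigenvector_positive_semidefinite_sqrt:
  assumes psd: "positive_semidefinite B" and B: "B \<in> carrier_mat n n"
    and p: "p \<in> carrier_vec n" and s: "0 \<le> s" and ev: "(B * B) *\<^sub>v p = (s * s) \<cdot>\<^sub>v p"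
  shows "B *\<^sub>v p = s \<cdot>\<^sub>v p"
proof -
  define y where "y = B *\<^sub>v p - s \<cdot>\<^sub>v p"
  have y: "y \<in> carrier_vec n" using B p by (simp add: y_def)
  have BBp: "B *\<^sub>v (B *\<^sub>v p) = (s * s) \<cdot>\<^sub>v p" using B p ev by simp
  have "y = 0\<^sub>v n"
  proof (cases "s = 0")
    case True
    then have "y = B *\<^sub>v p" using B p by (auto simp: y_def)
    then have "y \<bullet> y = p \<bullet> (B *\<^sub>v (B *\<^sub>v p))"
      using scalar_prod_symmetric_mat[OF B positive_semidefiniteD(1)[OF psd B] p, of "B *\<^sub>v p"] B p by simp
    also have "\<dots> = 0" using p True by (simp add: BBp)
    finally show ?thesis by (rule scalar_prod_self_eq_0[OF y])
  next
    case False
    have "B *\<^sub>v y = (s * s) \<cdot>\<^sub>v p - s \<cdot>\<^sub>v (B *\<^sub>v p)"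
      using B p by (simp add: y_def mult_minus_distrib_mat_vec[of _ n n] mult_mat_vec[of _ n n] BBp)
    also have "\<dots> = (- s) \<cdot>\<^sub>v y"
      using B p by (intro eq_vecI) (auto simp: y_def algebra_simps)
    finally have "y \<bullet> (B *\<^sub>v y) = - s * (y \<bullet> y)" using y by simp
    with positive_semidefiniteD(2)[OF psd B y] False s have "y \<bullet> y \<le> 0"
      by (simp add: mult_le_0_iff)
    then show ?thesis
      using scalar_prod_self_nonneg[of y] by (intro scalar_prod_self_eq_0[OF y]) simp
  qed
  then have "y $ i = 0" if "i < n" for i using that by simp
  then show ?thesis using B p by (intro eq_vecI) (auto simp: y_def)
qed

text \<open>An eigenvector of \<open>B\<close> for \<open>d i\<close> is an eigenvector of
  \<open>C * C\<close> for the square of \<open>d i\<close>, hence of \<open>C\<close> for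
  \<open>d i\<close> itself. So \<open>B\<close> and \<open>C\<close> agree on an eigenbasis of
  \<open>B\<close>.\<close>

lemma positive_semidefinite_sqrt_unique:
  assumes B: "positive_semidefinite B" "B \<in> carrier_mat n n"
    and C: "positive_semidefinite C" "C \<in> carrier_mat n n" and eq: "C * C = B * B"
  shows "C = B"
proof -
  obtain U d where U: "U \<in> carrier_mat n n" "U * transpose_mat U = 1\<^sub>m n"
    and ev: "\<And>i. i < n \<Longrightarrow> B *\<^sub>v col U i = d i \<cdot>\<^sub>v col U i"
    and unit: "\<And>i. i < n \<Longrightarrow> col U i \<bullet> col U i = 1"
    using symmetric_eigenbasis[OF B(2)] positive_semidefiniteD(1)[OF B] by metis
  show ?thesis
  proof (rule mat_eq_on_orthonormal_basis[OF C(2) B(2) U])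
    fix i assume i: "i < n"
    have p: "col U i \<in> carrier_vec n" using U i by simp
    have "0 \<le> d i" by (rule positive_semidefinite_eigenvalue_nonneg[OF B p unit ev]) (rule i)+
    moreover have "(C * C) *\<^sub>v col U i = (d i * d i) \<cdot>\<^sub>v col U i"
      using B p i by (simp add: eq ev mult_mat_vec[of _ n n] smult_smult_assoc)
    ultimately show "C *\<^sub>v col U i = B *\<^sub>v col U i"
      using eigenvector_positive_semidefinite_sqrt[OF C p] ev i by simp
  qed
qed

lemma psd_sqrt_eqI:
  assumes "positive_semidefinite B" "B \<in> carrier_mat n n"
  shows "psd_sqrt (B * B) = B"
  unfolding psd_sqrt_def
proof (rule the_equality)
  fix C assume C: "positive_semidefinite C \<and> C * C = B * B"
  \<comment> \<open>The description in \<open>psd_sqrt\<close> ranges over matrices of every size;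
    squareness of \<open>C\<close> and the dimension of \<open>C * C\<close> fix it.\<close>
  then have "C \<in> carrier_mat n n"
    using assms(2) unfolding positive_semidefinite_def
    by (metis carrier_matD(1) carrier_matI index_mult_mat(2) square_mat.elims(2))
  then show "C = B" using positive_semidefinite_sqrt_unique[OF assms] C by blast
qed (use assms in simp)

lemma psd_sqrt:
  assumes "positive_semidefinite M" "M \<in> carrier_mat n n"
  shows "positive_semidefinite (psd_sqrt M)" "psd_sqrt M * psd_sqrt M = M" "psd_sqrt M \<in> carrier_mat n n"
proof -
  obtain B where B: "positive_semidefinite B" "B * B = M"
    using positive_semidefinite_sqrt_exists[OF assms] by blast
  have "B \<in> carrier_mat n n"
    using assms(2) B unfolding positive_semidefinite_def
    by (metis carrier_matD(1) carrier_matI index_mult_mat(2) square_mat.elims(2))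
  with psd_sqrt_eqI[OF B(1)] B show "positive_semidefinite (psd_sqrt M)"
    "psd_sqrt M * psd_sqrt M = M" "psd_sqrt M \<in> carrier_mat n n" by auto
qed

section \<open>Traces and domination\<close>

lemma mat_trace_eq_sum: "A \<in> carrier_mat n n \<Longrightarrow> mat_trace A = (\<Sum>i<n. A $$ (i, i))"
  by (simp add: mat_trace_def diag_mat_def interv_sum_list_conv_sum_set_nat lessThan_atLeast0)

lemma mat_trace_comm:
  assumes "A \<in> carrier_mat n m" "B \<in> carrier_mat m n"
  shows "mat_trace (A * B) = mat_trace (B * A)"
proof -
  have "mat_trace (A * B) = (\<Sum>i<n. \<Sum>l<m. A $$ (i, l) * B $$ (l, i))"
    using assms by (simp add: mat_trace_eq_sum[of _ n] index_mat_mult_sum[of _ n m _ n] del: index_mult_mat(1))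
  also have "\<dots> = (\<Sum>l<m. \<Sum>i<n. B $$ (l, i) * A $$ (i, l))"
    by (subst sum.swap) (simp add: mult.commute)
  also have "\<dots> = mat_trace (B * A)"
    using assms by (simp add: mat_trace_eq_sum[of _ m] index_mat_mult_sum[of _ m n _ m] del: index_mult_mat(1))
  finally show ?thesis .
qed

text \<open>By cyclicity the trace is that of \<open>transpose_mat U * (M * U)\<close>, whose
  diagonal consists of the values of the quadratic form at the columns of \<open>U\<close>.\<close>

lemma mat_trace_orthonormal_basis:
  assumes M: "M \<in> carrier_mat n n" and U: "U \<in> carrier_mat n n" "U * transpose_mat U = 1\<^sub>m n"
  shows "mat_trace M = (\<Sum>i<n. col U i \<bullet> (M *\<^sub>v col U i))"
proof -
  have "mat_trace M = mat_trace (M * (U * transpose_mat U))" using M by (simp add: U)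
  also have "\<dots> = mat_trace ((M * U) * transpose_mat U)"
    using assoc_mult_mat[OF M U(1), of "transpose_mat U" n] U by simp
  also have "\<dots> = mat_trace (transpose_mat U * (M * U))"
    using M U by (intro mat_trace_comm) auto
  also have "\<dots> = (\<Sum>i<n. (transpose_mat U * (M * U)) $$ (i, i))"
    using M U by (intro mat_trace_eq_sum) auto
  also have "\<dots> = (\<Sum>i<n. col U i \<bullet> (M *\<^sub>v col U i))"
  proof (rule sum.cong[OF refl])
    fix i assume "i \<in> {..<n}"
    then have i: "i < n" by simp
    then have "(transpose_mat U * (M * U)) $$ (i, i) = col U i \<bullet> col (M * U) i"
      using M U by simp
    then show "(transpose_mat U * (M * U)) $$ (i, i) = col U i \<bullet> (M *\<^sub>v col U i)"
      by (simp only: col_mult2[OF M U(1) i])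
  qed
  finally show ?thesis .
qed

text \<open>In an orthonormal eigenbasis of \<open>S\<close> every diagonal entry of \<open>M\<close> is at most the eigenvalue;
  equality of the traces forces equality in each Cauchy--Schwarz step.\<close>

lemma eq_of_mat_trace_eq_of_dominated:
  assumes S: "positive_semidefinite S" "S \<in> carrier_mat n n" and M: "M \<in> carrier_mat n n"
    and dom: "\<And>x. x \<in> carrier_vec n \<Longrightarrow> (M *\<^sub>v x) \<bullet> (M *\<^sub>v x) \<le> (S *\<^sub>v x) \<bullet> (S *\<^sub>v x)"
    and trace: "mat_trace M = mat_trace S"
  shows "M = S"
proof -
  obtain U d where U: "U \<in> carrier_mat n n" "U * transpose_mat U = 1\<^sub>m n"
    and ev: "\<And>i. i < n \<Longrightarrow> S *\<^sub>v col U i = d i \<cdot>\<^sub>v col U i"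
    and unit: "\<And>i. i < n \<Longrightarrow> col U i \<bullet> col U i = 1"
    using symmetric_eigenbasis[OF S(2)] positive_semidefiniteD(1)[OF S] by metis
  define t where "t i = col U i \<bullet> (M *\<^sub>v col U i)" for i
  \<comment> \<open>With \<open>p = col U i\<close>, domination bounds the squared norm of
    \<open>M *\<^sub>v p\<close> by \<open>d i * d i\<close>; expanding the squared distance from
    \<open>d i \<cdot>\<^sub>v p\<close> gives the bound. As a squared norm is nonnegative,
    \<open>t i \<le> d i\<close> follows when \<open>d i > 0\<close>; when \<open>d i = 0\<close>,
    domination makes \<open>M *\<^sub>v p\<close> vanish.\<close>
  have defect: "(M *\<^sub>v col U i - d i \<cdot>\<^sub>v col U i) \<bullet> (M *\<^sub>v col U i - d i \<cdot>\<^sub>v col U i) \<le> 2 * d i * (d i - t i)"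
    and le: "t i \<le> d i" if i: "i < n" for i
  proof -
    have p: "col U i \<in> carrier_vec n" using U i by simp
    have nonneg: "0 \<le> d i" by (rule positive_semidefinite_eigenvalue_nonneg[OF S p unit ev]) (rule i)+
    have Mp: "M *\<^sub>v col U i \<in> carrier_vec n" using M p by simp
    have bound: "(M *\<^sub>v col U i) \<bullet> (M *\<^sub>v col U i) \<le> d i * d i"
      using dom[OF p] p unit[OF i] by (simp add: ev i)
    have "(M *\<^sub>v col U i - d i \<cdot>\<^sub>v col U i) \<bullet> (M *\<^sub>v col U i - d i \<cdot>\<^sub>v col U i)
        = (M *\<^sub>v col U i) \<bullet> (M *\<^sub>v col U i) - 2 * (d i * t i) + d i * d i"
      using p Mp M U unit[OF i] by (simp add: scalar_prod_diff_self[of _ n] t_def)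
    with bound show *: "(M *\<^sub>v col U i - d i \<cdot>\<^sub>v col U i) \<bullet> (M *\<^sub>v col U i - d i \<cdot>\<^sub>v col U i) \<le> 2 * d i * (d i - t i)"
      by (simp add: algebra_simps)
    show "t i \<le> d i"
    proof (cases "d i = 0")
      case True
      then have "M *\<^sub>v col U i = 0\<^sub>v n"
        using bound scalar_prod_self_nonneg[of "M *\<^sub>v col U i"] by (intro scalar_prod_self_eq_0[OF Mp]) simp
      then show ?thesis using p True by (simp add: t_def)
    next
      case False
      have "0 \<le> 2 * d i * (d i - t i)" by (rule order_trans[OF scalar_prod_self_nonneg *])
      with False nonneg show ?thesis by (simp add: zero_le_mult_iff)
    qed
  qed
  have "mat_trace S = (\<Sum>i<n. d i)"
    unfolding mat_trace_orthonormal_basis[OF S(2) U] using U unit by (intro sum.cong) (auto simp: ev)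
  then have "(\<Sum>i<n. d i - t i) = 0"
    using trace by (simp add: mat_trace_orthonormal_basis[OF M U] t_def sum_subtractf)
  then have t: "t i = d i" if "i < n" for i
    using le that by (subst (asm) sum_nonneg_eq_0_iff) auto
  show ?thesis
  proof (rule mat_eq_on_orthonormal_basis[OF M S(2) U])
    fix i assume i: "i < n"
    define y where "y = M *\<^sub>v col U i - d i \<cdot>\<^sub>v col U i"
    have y: "y \<in> carrier_vec n" using M U i by (simp add: y_def)
    have "y \<bullet> y \<le> 0" using defect[OF i] by (simp add: y_def t i)
    then have "y = 0\<^sub>v n"
      using scalar_prod_self_nonneg[of y] by (intro scalar_prod_self_eq_0[OF y]) simp
    then have "y $ j = 0" if "j < n" for j using that by simp
    then show "M *\<^sub>v col U i = S *\<^sub>v col U i"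
      unfolding ev[OF i] using M U i by (intro eq_vecI) (auto simp: y_def)
  qed
qed

section \<open>Normalized zero-one matrices\<close>

text \<open>The inclusion of \<open>E\<close> composed with its converse and again with
  \<open>E\<close> in \<open>E\<close> itself. Equivalently, any two out-neighborhoods are equal or
  disjoint, so that \<open>E\<close> is a union of rectangles with pairwise disjoint sides.\<close>

definition difunctional :: "('a \<times> 'b) set \<Rightarrow> bool" where
  "difunctional E \<longleftrightarrow> (\<forall>v w u w'. (v, w) \<in> E \<longrightarrow> (u, w) \<in> E \<longrightarrow> (v, w') \<in> E \<longrightarrow> (u, w') \<in> E)"

locale zero_one_matrix =
  fixes n :: nat and R :: "nat \<Rightarrow> nat \<Rightarrow> bool"
begin

definition a :: "nat \<Rightarrow> nat \<Rightarrow> real" where "a i j = (if R i j then 1 else 0)"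

definition r :: "nat \<Rightarrow> real" where "r i = (\<Sum>j<n. a i j)"

definition c :: "nat \<Rightarrow> real" where "c j = (\<Sum>i<n. a i j)"

definition A :: "real mat" where "A = mat n n (\<lambda>(i, j). a i j)"

text \<open>The matrix \<open>A\<close> scaled on both sides by the inverse square roots of its row
  and column sums. On a zero row or column the entry is 0, as \<open>a i j\<close> vanishes
  there.\<close>

definition N :: "real mat" where "N = mat n n (\<lambda>(i, j). a i j / sqrt (r i * c j))"

text \<open>The restriction to indices below \<open>n\<close> matters because for digraphs
  \<open>R\<close> is read off from \<open>vs ! i\<close>, which is unspecified past the end of the
  list.\<close>

definition support :: "(nat \<times> nat) set" where
  "support = {(i, j). i < n \<and> j < n \<and> R i j}"

lemma carrier [simp]: "A \<in> carrier_mat n n" "N \<in> carrier_mat n n"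
  by (simp_all add: A_def N_def)

lemma gram_carrier [simp]:
  "A * transpose_mat A \<in> carrier_mat n n" "N * transpose_mat A \<in> carrier_mat n n"
  by (rule mult_carrier_mat[of _ n n]; simp)+

lemma index_A [simp]: "i < n \<Longrightarrow> j < n \<Longrightarrow> A $$ (i, j) = a i j"
  and index_N [simp]: "i < n \<Longrightarrow> j < n \<Longrightarrow> N $$ (i, j) = a i j / sqrt (r i * c j)"
  by (simp_all add: A_def N_def)

lemma a_nonneg [simp]: "0 \<le> a i j" and a_square [simp]: "a i j * a i j = a i j" "(a i j)\<^sup>2 = a i j"
  by (simp_all add: a_def)

lemma r_nonneg [simp]: "0 \<le> r i" and c_nonneg [simp]: "0 \<le> c j"
  by (simp_all add: r_def c_def sum_nonneg)

lemma r_pos: "R i j \<Longrightarrow> j < n \<Longrightarrow> 0 < r i"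
  unfolding r_def by (rule sum_pos2[of _ j]) (auto simp: a_def)

lemma c_pos: "R i j \<Longrightarrow> i < n \<Longrightarrow> 0 < c j"
  unfolding c_def by (rule sum_pos2[of _ i]) (auto simp: a_def)

text \<open>Cauchy-Schwarz in each row, with the weight \<open>r i\<close> put in one factor and the
  weights \<open>c w\<close> in the other. Summed over the rows, the square of \<open>x $ w\<close>
  gets the coefficient \<open>c w / c w\<close>, which is at most 1.\<close>

lemma N_contraction:
  assumes x: "x \<in> carrier_vec n"
  shows "(N *\<^sub>v x) \<bullet> (N *\<^sub>v x) \<le> x \<bullet> x"
proof -
  have row: "((N *\<^sub>v x) $ i)\<^sup>2 \<le> (\<Sum>w<n. a i w * (x $ w)\<^sup>2 / c w)" if i: "i < n" for i
  proof -
    have Nx: "(N *\<^sub>v x) $ i = (\<Sum>w<n. (a i w / sqrt (r i)) * (a i w * x $ w / sqrt (c w)))"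
      using i x carrier_matD[OF carrier(2)]
      by (auto simp: scalar_prod_def lessThan_atLeast0 real_sqrt_mult a_def intro!: sum.cong)
    have "((N *\<^sub>v x) $ i)\<^sup>2
        \<le> (\<Sum>w<n. (a i w / sqrt (r i))\<^sup>2) * (\<Sum>w<n. (a i w * x $ w / sqrt (c w))\<^sup>2)"
      unfolding Nx by (rule Cauchy_Schwarz_ineq_sum)
    also have "\<dots> = r i / r i * (\<Sum>w<n. a i w * (x $ w)\<^sup>2 / c w)"
      by (simp add: power_divide power_mult_distrib sum_divide_distrib[symmetric] r_def[symmetric])
    \<comment> \<open>For a zero row the quotient \<open>r i / r i\<close> is 0, so there is only an
      inequality; zero columns behave likewise below.\<close>
    also have "\<dots> \<le> 1 * (\<Sum>w<n. a i w * (x $ w)\<^sup>2 / c w)"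
      by (intro mult_right_mono sum_nonneg) auto
    finally show ?thesis by simp
  qed
  have "(N *\<^sub>v x) \<bullet> (N *\<^sub>v x) = (\<Sum>i<n. ((N *\<^sub>v x) $ i)\<^sup>2)"
    using carrier_matD[OF carrier(2)] by (simp add: scalar_prod_def lessThan_atLeast0 power2_eq_square)
  also have "\<dots> \<le> (\<Sum>i<n. \<Sum>w<n. a i w * (x $ w)\<^sup>2 / c w)"
    by (rule sum_mono) (use row in simp)
  also have "\<dots> = (\<Sum>w<n. \<Sum>i<n. a i w * (x $ w)\<^sup>2 / c w)" by (rule sum.swap)
  also have "\<dots> = (\<Sum>w<n. c w / c w * (x $ w)\<^sup>2)"
    by (simp add: sum_distrib_right[symmetric] sum_divide_distrib[symmetric] c_def[symmetric])
      (auto intro!: sum.cong)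
  also have "\<dots> \<le> (\<Sum>w<n. 1 * (x $ w)\<^sup>2)"
    by (intro sum_mono mult_right_mono) auto
  also have "\<dots> = x \<bullet> x"
    using x by (simp add: scalar_prod_def lessThan_atLeast0 power2_eq_square)
  finally show ?thesis .
qed

section \<open>From equality of traces to difunctionality\<close>

lemma index_gram: "i < n \<Longrightarrow> u < n \<Longrightarrow> (A * transpose_mat A) $$ (i, u) = (\<Sum>w<n. a i w * a u w)"
  by (subst index_mat_mult_sum[of _ n n _ n]) (auto simp: carrier_matD[OF carrier(1)])

lemma index_N_gram:
  "i < n \<Longrightarrow> u < n \<Longrightarrow> (N * transpose_mat A) $$ (i, u) = (\<Sum>w<n. a i w * a u w / sqrt (r i * c w))"
  by (subst index_mat_mult_sum[of _ n n _ n]) (auto simp: carrier_matD[OF carrier(1)])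

lemma mat_trace_N_gram:
  "mat_trace (N * transpose_mat A) = (\<Sum>i<n. \<Sum>w<n. a i w / sqrt (r i * c w))"
  by (subst mat_trace_eq_sum[of _ n]) (auto simp: index_N_gram simp del: index_mult_mat)

text \<open>Cauchy-Schwarz over the columns common to rows \<open>i\<close> and \<open>u\<close>.
  For \<open>r i > 0\<close> the first factor is at most 1, with value 1 only if row
  \<open>u\<close> contains row \<open>i\<close>; the equality case turns on this.\<close>

lemma N_gram_entry_le:
  assumes "i < n" "u < n"
  shows "((N * transpose_mat A) $$ (i, u))\<^sup>2
    \<le> (\<Sum>w<n. a i w * a u w) / r i * (\<Sum>w<n. a i w * a u w / c w)"
proof -
  have entry: "(N * transpose_mat A) $$ (i, u)
      = (\<Sum>w<n. (a i w * a u w / sqrt (r i)) * (a i w * a u w / sqrt (c w)))"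
    unfolding index_N_gram[OF assms] by (auto simp: real_sqrt_mult a_def intro!: sum.cong)
  have "((N * transpose_mat A) $$ (i, u))\<^sup>2
      \<le> (\<Sum>w<n. (a i w * a u w / sqrt (r i))\<^sup>2) * (\<Sum>w<n. (a i w * a u w / sqrt (c w))\<^sup>2)"
    unfolding entry by (rule Cauchy_Schwarz_ineq_sum)
  also have "\<dots> = (\<Sum>w<n. a i w * a u w) / r i * (\<Sum>w<n. a i w * a u w / c w)"
    by (simp add: power_divide power_mult_distrib sum_divide_distrib)
  finally show ?thesis .
qed

text \<open>Contractivity of \<open>N\<close> bounds the norm of
  \<open>(N * transpose_mat A) *\<^sub>v x\<close> by that of
  \<open>transpose_mat A *\<^sub>v x\<close>, which is the norm of \<open>S *\<^sub>v x\<close>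
  because \<open>S * S\<close> is the Gram matrix. The trace criterion for dominated matrices then
  applies.\<close>

lemma N_gram_eq_psd_sqrt:
  assumes "mat_trace (N * transpose_mat A) = mat_trace (psd_sqrt (A * transpose_mat A))"
  shows "N * transpose_mat A = psd_sqrt (A * transpose_mat A)"
proof -
  define S where "S = psd_sqrt (A * transpose_mat A)"
  have S: "positive_semidefinite S" "S * S = A * transpose_mat A" "S \<in> carrier_mat n n"
    using psd_sqrt[OF positive_semidefinite_gram[OF carrier(1)], of n] by (auto simp: S_def)
  have "N * transpose_mat A = S"
  proof (rule eq_of_mat_trace_eq_of_dominated[OF S(1,3)])
    fix x :: "real vec" assume x: "x \<in> carrier_vec n"
    have "((N * transpose_mat A) *\<^sub>v x) = N *\<^sub>v (transpose_mat A *\<^sub>v x)"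
      by (rule assoc_mult_mat_vec[of _ n n _ n]) (use x in auto)
    then have "((N * transpose_mat A) *\<^sub>v x) \<bullet> ((N * transpose_mat A) *\<^sub>v x)
        \<le> (transpose_mat A *\<^sub>v x) \<bullet> (transpose_mat A *\<^sub>v x)"
      using N_contraction[OF mult_mat_vec_carrier[OF _ x, of "transpose_mat A" n]] by simp
    also have "\<dots> = x \<bullet> ((S * S) *\<^sub>v x)"
      unfolding S(2) by (rule scalar_prod_gram[OF carrier(1) x, symmetric])
    also have "\<dots> = (S *\<^sub>v x) \<bullet> (S *\<^sub>v x)"
      using scalar_prod_symmetric_mat[OF S(3) positive_semidefiniteD(1)[OF S(1,3)] x, of "S *\<^sub>v x"] S(3) x
      by simp
    finally show "((N * transpose_mat A) *\<^sub>v x) \<bullet> ((N * transpose_mat A) *\<^sub>v x) \<le> (S *\<^sub>v x) \<bullet> (S *\<^sub>v x)" .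
  qed (use assms in \<open>auto simp: S_def\<close>)
  then show ?thesis by (simp add: S_def)
qed

lemma difunctional_if_trace_eq:
  assumes "mat_trace (N * transpose_mat A) = mat_trace (psd_sqrt (A * transpose_mat A))"
  shows "difunctional support"
  unfolding difunctional_def
proof (intro allI impI)
  fix i w u w' assume "(i, w) \<in> support" "(u, w) \<in> support" "(i, w') \<in> support"
  then have *: "i < n" "u < n" "w < n" "w' < n" "R i w" "R u w" "R i w'"
    by (auto simp: support_def)
  define M where "M = N * transpose_mat A"
  have M: "M \<in> carrier_mat n n" by (simp add: M_def)
  have "M = psd_sqrt (A * transpose_mat A)" using N_gram_eq_psd_sqrt[OF assms] by (simp add: M_def)
  then have MM: "M * M = A * transpose_mat A" "transpose_mat M = M"
    using psd_sqrt[OF positive_semidefinite_gram[OF carrier(1)], of n] positive_semidefiniteD(1)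
    by auto
  \<comment> \<open>Over \<open>u\<close>, both the squares of \<open>M $$ (i, u)\<close> and the
    numbers \<open>q u\<close> sum to \<open>r i\<close>: the former through the diagonal of
    \<open>M * M\<close>, the latter because \<open>c w\<close> cancels wherever
    \<open>a i w\<close> is nonzero. As each square is at most \<open>q u\<close>, all these
    inequalities are equalities.\<close>
  define q where "q u = (\<Sum>w<n. a i w * a u w / c w)" for u
  have q_nonneg: "0 \<le> q u" for u by (simp add: q_def sum_nonneg)
  have "(\<Sum>u<n. (M $$ (i, u))\<^sup>2) = (\<Sum>u<n. M $$ (i, u) * transpose_mat M $$ (u, i))"
    using M * by (intro sum.cong) (auto simp: power2_eq_square)
  also have "\<dots> = (M * M) $$ (i, i)"
    unfolding MM(2) by (rule index_mat_mult_sum[OF M M, symmetric]) (use * in auto)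
  also have "\<dots> = r i" unfolding MM(1) using * by (simp add: index_gram r_def del: index_mult_mat)
  also have "\<dots> = (\<Sum>w<n. \<Sum>u<n. a i w * a u w / c w)"
    unfolding r_def
  proof (rule sum.cong[OF refl])
    fix x assume "x \<in> {..<n}"
    have "(\<Sum>u<n. a i x * a u x / c x) = a i x * c x / c x"
      unfolding c_def by (simp add: sum_distrib_left sum_divide_distrib)
    then show "a i x = (\<Sum>u<n. a i x * a u x / c x)"
      using c_pos[of i x] * by (auto simp: a_def)
  qed
  also have "\<dots> = (\<Sum>u<n. q u)" unfolding q_def by (rule sum.swap)
  finally have sum0: "(\<Sum>u<n. q u - (M $$ (i, u))\<^sup>2) = 0" by (simp add: sum_subtractf)
  have le: "(M $$ (i, u))\<^sup>2 \<le> (\<Sum>w<n. a i w * a u w) / r i * q u" if "u < n" for u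
    using N_gram_entry_le[OF *(1) that] by (simp add: M_def q_def del: index_mult_mat)
  have ri: "0 < r i" using r_pos * by blast
  have "(\<Sum>w<n. a i w * a u w) \<le> r i" for u
    unfolding r_def by (rule sum_mono) (auto simp: a_def)
  then have "(\<Sum>w<n. a i w * a u w) / r i * q u \<le> 1 * q u" for u
    using q_nonneg ri by (intro mult_right_mono) auto
  with le have "(M $$ (i, u))\<^sup>2 \<le> q u" if "u < n" for u using that by (metis mult_1 order_trans)
  then have "q u = (M $$ (i, u))\<^sup>2"
    using sum0 *(2) by (subst (asm) sum_nonneg_eq_0_iff) auto
  \<comment> \<open>Cancelling \<open>q u\<close>, which is positive thanks to the common column
    \<open>w\<close>, leaves that rows \<open>i\<close> and \<open>u\<close> have at least
    \<open>r i\<close> common columns. Hence row \<open>u\<close> contains row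
    \<open>i\<close>.\<close>
  then have "q u * r i \<le> (\<Sum>w<n. a i w * a u w) * q u" using le[OF *(2)] ri by (simp add: field_simps)
  moreover have "0 < q u"
    unfolding q_def by (rule sum_pos2[of _ w]) (use * c_pos in \<open>auto simp: a_def\<close>)
  ultimately have "(\<Sum>w<n. a i w) \<le> (\<Sum>w<n. a i w * a u w)" by (simp add: r_def)
  then have "(\<Sum>w<n. a i w - a i w * a u w) \<le> 0" by (simp add: sum_subtractf)
  moreover have "0 \<le> a i w - a i w * a u w" for w by (simp add: a_def)
  ultimately have "(\<Sum>w<n. a i w - a i w * a u w) = 0"
    by (intro antisym sum_nonneg) auto
  then have "a i w' - a i w' * a u w' = 0"
    using *(4) by (subst (asm) sum_nonneg_eq_0_iff) (auto simp: a_def)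
  then show "(u, w') \<in> support" using * by (auto simp: a_def support_def split: if_splits)
qed

section \<open>The explicit square root for a difunctional relation\<close>

context
  assumes dif: "difunctional support"
begin

lemma difunctionalD: "R i w \<Longrightarrow> R u w \<Longrightarrow> R i w' \<Longrightarrow> i < n \<Longrightarrow> u < n \<Longrightarrow> w < n \<Longrightarrow> w' < n \<Longrightarrow> R u w'"
  using dif unfolding difunctional_def support_def by blast

text \<open>Two rows sharing a nonzero column coincide on the columns below \<open>n\<close>;
  applying difunctionality in both directions shows this.\<close>

lemma r_eq: "R i w \<Longrightarrow> R u w \<Longrightarrow> i < n \<Longrightarrow> u < n \<Longrightarrow> w < n \<Longrightarrow> r i = r u"
  unfolding r_def using difunctionalD[of i w u] difunctionalD[of u w i]
  by (intro sum.cong) (auto simp: a_def)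

lemma c_eq: "R i w \<Longrightarrow> R i w' \<Longrightarrow> i < n \<Longrightarrow> w < n \<Longrightarrow> w' < n \<Longrightarrow> c w = c w'"
  unfolding c_def using difunctionalD[of i w _ w'] difunctionalD[of i w' _ w]
  by (intro sum.cong) (auto simp: a_def)

text \<open>Fourth roots turn \<open>N A\<^sup>T\<close> into a Gram matrix, because rows with a common
  nonzero column have equal sums.\<close>

lemma positive_semidefinite_N_gram: "positive_semidefinite (N * transpose_mat A)"
proof -
  define K where "K = mat n n (\<lambda>(i, w). a i w / sqrt (sqrt (r i * c w)))"
  have K: "K \<in> carrier_mat n n" by (simp add: K_def)
  have "N * transpose_mat A = K * transpose_mat K"
  proof (rule eq_matI)
    fix i u assume "i < dim_row (K * transpose_mat K)" "u < dim_col (K * transpose_mat K)"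
    then have iu: "i < n" "u < n" using K by auto
    have "(K * transpose_mat K) $$ (i, u)
        = (\<Sum>w<n. (a i w / sqrt (sqrt (r i * c w))) * (a u w / sqrt (sqrt (r u * c w))))"
      using iu by (subst index_mat_mult_sum[of _ n n _ n]) (auto simp: K_def)
    also have "\<dots> = (N * transpose_mat A) $$ (i, u)"
      unfolding index_N_gram[OF iu] using r_eq[of i _ u] iu
      by (intro sum.cong) (auto simp: a_def)
    finally show "(N * transpose_mat A) $$ (i, u) = (K * transpose_mat K) $$ (i, u)" by simp
  qed (use K carrier_matD[OF carrier(1)] carrier_matD[OF carrier(2)] in auto)
  then show ?thesis using positive_semidefinite_gram[OF K] by simp
qed

text \<open>The entry sums over zigzags with \<open>R v y\<close>, \<open>R x y\<close> and
  \<open>R x w\<close>. Each forces \<open>R v w\<close>, \<open>r x = r v\<close> and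
  \<open>c y = c w\<close>, so it contributes \<open>1 / (r v * c w)\<close>. Conversely, if
  \<open>R v w\<close> holds, \<open>R v y\<close> and \<open>R x w\<close> already imply
  \<open>R x y\<close>, so there are \<open>r v * c w\<close> zigzags and the total is 1.\<close>

lemma N_gram_N: "(N * transpose_mat A) * N = A"
proof (rule eq_matI)
  fix v w assume "v < dim_row A" "w < dim_col A"
  then have vw: "v < n" "w < n" using carrier_matD[OF carrier(1)] by auto
  have "((N * transpose_mat A) * N) $$ (v, w) = (\<Sum>x<n. (N * transpose_mat A) $$ (v, x) * N $$ (x, w))"
    by (rule index_mat_mult_sum) (use vw in auto)
  also have "\<dots> = (\<Sum>x<n. \<Sum>y<n. a v y * a x y / sqrt (r v * c y) * (a x w / sqrt (r x * c w)))"
    using vw by (intro sum.cong) (auto simp: index_N_gram sum_distrib_right sum_divide_distrib simp del: index_mult_mat)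
  also have "\<dots> = (\<Sum>x<n. \<Sum>y<n. a v w / (r v * c w) * (a v y * a x w))"
  proof (intro sum.cong refl)
    fix x y assume "x \<in> {..<n}" "y \<in> {..<n}"
    then have xy: "x < n" "y < n" by auto
    show "a v y * a x y / sqrt (r v * c y) * (a x w / sqrt (r x * c w)) = a v w / (r v * c w) * (a v y * a x w)"
    proof (cases "R v y \<and> R x y \<and> R x w")
      case True
      then have "R v w" "r x = r v" "c y = c w"
        using difunctionalD[of x y v w] r_eq[of x y v] c_eq[of x y w] vw xy by auto
      with True show ?thesis by (simp add: a_def)
    next
      case False
      then have "\<not> (R v w \<and> R v y \<and> R x w)" using difunctionalD[of v w x y] vw xy by blast
      with False show ?thesis by (auto simp: a_def)
    qed
  qed
  also have "\<dots> = a v w / (r v * c w) * (r v * c w)"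
    unfolding r_def c_def sum_product
    by (subst sum.swap) (simp add: sum_distrib_left sum_distrib_right)
  also have "\<dots> = A $$ (v, w)" using vw r_pos[of v w] c_pos[of v w] by (auto simp: a_def)
  finally show "((N * transpose_mat A) * N) $$ (v, w) = A $$ (v, w)" .
qed (use carrier_matD[OF carrier(1)] carrier_matD[OF carrier(2)] in auto)

lemma psd_sqrt_gram: "psd_sqrt (A * transpose_mat A) = N * transpose_mat A"
proof -
  have "(N * transpose_mat A) * (N * transpose_mat A) = ((N * transpose_mat A) * N) * transpose_mat A"
    by (rule assoc_mult_mat[of _ n n _ n _ n, symmetric]) auto
  then have "(N * transpose_mat A) * (N * transpose_mat A) = A * transpose_mat A"
    by (simp only: N_gram_N)
  then show ?thesis using psd_sqrt_eqI[OF positive_semidefinite_N_gram, of n] by simp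
qed

end

lemma mat_trace_psd_sqrt_gram_iff:
  "mat_trace (psd_sqrt (A * transpose_mat A)) = (\<Sum>i<n. \<Sum>w<n. a i w / sqrt (r i * c w)) \<longleftrightarrow> difunctional support"
  using difunctional_if_trace_eq psd_sqrt_gram by (auto simp: mat_trace_N_gram)

end

section \<open>Digraphs\<close>

lemma out_degree_with_proj: "out_degree (with_proj G) v = card {w. (v, w) \<in> parcs G}"
proof -
  have "out_arcs (with_proj G) v = Pair v ` {w. (v, w) \<in> parcs G}"
    by (auto simp: out_arcs_def)
  then show ?thesis by (simp add: out_degree_def card_image inj_on_def)
qed

lemma in_degree_with_proj: "in_degree (with_proj G) w = card {v. (v, w) \<in> parcs G}"
proof -
  have "in_arcs (with_proj G) w = (\<lambda>v. (v, w)) ` {v. (v, w) \<in> parcs G}"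
    by (auto simp: in_arcs_def)
  then show ?thesis by (simp add: in_degree_def card_image inj_on_def)
qed

lemma (in pair_fin_digraph) finite_neighbours:
  "finite {w. (v, w) \<in> parcs G}" "finite {v. (v, w) \<in> parcs G}"
proof -
  have "{w. (v, w) \<in> parcs G} \<subseteq> snd ` parcs G" "{v. (v, w) \<in> parcs G} \<subseteq> fst ` parcs G" by force+
  then show "finite {w. (v, w) \<in> parcs G}" "finite {v. (v, w) \<in> parcs G}"
    using pair_finite_arcs by (auto elim: finite_subset)
qed

text \<open>The enumeration identifies indices below \<open>length vs\<close> with vertices. Row and
  column sums become degrees and the trace of \<open>N * transpose_mat A\<close> becomes twice the
  Randic index, which turns the matrix criterion into one on the arcs alone.\<close>

lemma energy_eq_two_randic_iff_difunctional:
  assumes G: "pair_digraph G" and vs: "distinct vs" "set vs = pverts G"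
  shows "energy vs G = 2 * randic_index G \<longleftrightarrow> difunctional (parcs G)"
proof -
  interpret pair_digraph G by (rule G)
  let ?n = "length vs" and ?E = "parcs G" and ?V = "pverts G"
  interpret Z: zero_one_matrix ?n "\<lambda>i j. (vs ! i, vs ! j) \<in> ?E" .
  have bij: "bij_betw (nth vs) {..<?n} ?V"
    using bij_betw_nth[OF vs(1) refl vs(2)[symmetric]] .
  have EV: "?E \<subseteq> ?V \<times> ?V" using in_arcsD1 in_arcsD2 by auto
  have A: "adjacency_matrix vs G = Z.A"
    by (simp add: adjacency_matrix_def Z.A_def Z.a_def)
  have r: "Z.r i = real (out_degree (with_proj G) (vs ! i))" for i
  proof -
    have "Z.r i = (\<Sum>w\<in>?V. if (vs ! i, w) \<in> ?E then 1 else 0)"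
      unfolding Z.r_def Z.a_def by (rule sum.reindex_bij_betw[OF bij])
    also have "\<dots> = real (card {w \<in> ?V. (vs ! i, w) \<in> ?E})"
      using pair_finite_verts by (simp add: sum.If_cases Int_def)
    also have "{w \<in> ?V. (vs ! i, w) \<in> ?E} = {w. (vs ! i, w) \<in> ?E}" using EV by auto
    finally show ?thesis by (simp add: out_degree_with_proj)
  qed
  have c: "Z.c j = real (in_degree (with_proj G) (vs ! j))" for j
  proof -
    have "Z.c j = (\<Sum>v\<in>?V. if (v, vs ! j) \<in> ?E then 1 else 0)"
      unfolding Z.c_def Z.a_def by (rule sum.reindex_bij_betw[OF bij])
    also have "\<dots> = real (card {v \<in> ?V. (v, vs ! j) \<in> ?E})"
      using pair_finite_verts by (simp add: sum.If_cases Int_def)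
    also have "{v \<in> ?V. (v, vs ! j) \<in> ?E} = {v. (v, vs ! j) \<in> ?E}" using EV by auto
    finally show ?thesis by (simp add: in_degree_with_proj)
  qed
  let ?f = "\<lambda>v w. 1 / sqrt (real (out_degree (with_proj G) v) * real (in_degree (with_proj G) w))"
  have "(\<Sum>i<?n. \<Sum>j<?n. Z.a i j / sqrt (Z.r i * Z.c j))
      = (\<Sum>i<?n. \<Sum>j<?n. if (vs ! i, vs ! j) \<in> ?E then ?f (vs ! i) (vs ! j) else 0)"
    by (intro sum.cong refl) (auto simp: Z.a_def r c)
  also have "\<dots> = (\<Sum>i<?n. \<Sum>w\<in>?V. if (vs ! i, w) \<in> ?E then ?f (vs ! i) w else 0)"
    by (intro sum.cong refl sum.reindex_bij_betw[OF bij])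
  also have "\<dots> = (\<Sum>v\<in>?V. \<Sum>w\<in>?V. if (v, w) \<in> ?E then ?f v w else 0)"
    by (rule sum.reindex_bij_betw[OF bij])
  also have "\<dots> = (\<Sum>(v, w)\<in>?V \<times> ?V. if (v, w) \<in> ?E then ?f v w else 0)"
    by (rule sum.cartesian_product)
  also have "\<dots> = (\<Sum>(v, w)\<in>?E. ?f v w)"
    using EV pair_finite_verts by (intro sum.mono_neutral_cong_right) auto
  also have "\<dots> = 2 * randic_index G" by (simp add: randic_index_def)
  finally have randic: "2 * randic_index G = (\<Sum>i<?n. \<Sum>j<?n. Z.a i j / sqrt (Z.r i * Z.c j))" ..
  have "energy vs G = mat_trace (psd_sqrt (Z.A * transpose_mat Z.A))"
    by (simp add: energy_def A Let_def)
  then have "energy vs G = 2 * randic_index G \<longleftrightarrow> difunctional Z.support"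
    unfolding randic by (simp only: Z.mat_trace_psd_sqrt_gram_iff)
  also have "\<dots> \<longleftrightarrow> difunctional ?E"
  proof
    assume *: "difunctional Z.support"
    show "difunctional ?E"
      unfolding difunctional_def
    proof (intro allI impI)
      fix v w u w' assume E: "(v, w) \<in> ?E" "(u, w) \<in> ?E" "(v, w') \<in> ?E"
      then have "v \<in> set vs" "w \<in> set vs" "u \<in> set vs" "w' \<in> set vs" using EV vs by auto
      then obtain i j k l where "i < ?n" "j < ?n" "k < ?n" "l < ?n"
        "v = vs ! i" "w = vs ! j" "u = vs ! k" "w' = vs ! l" by (metis in_set_conv_nth)
      with * E show "(u, w') \<in> ?E" unfolding difunctional_def Z.support_def by blast
    qed
  next
    assume "difunctional ?E"
    then show "difunctional Z.support" unfolding Z.support_def difunctional_def by blast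
  qed
  finally show ?thesis .
qed

section \<open>Complete bipartite pieces and splittings\<close>

definition biclique :: "'a set \<Rightarrow> 'a set \<Rightarrow> 'a pair_pre_digraph" where
  "biclique X Y = \<lparr> pverts = X \<union> Y, parcs = X \<times> Y \<rparr>"

lemma biclique_simps [simp]: "pverts (biclique X Y) = X \<union> Y" "parcs (biclique X Y) = X \<times> Y"
  by (simp_all add: biclique_def)

lemma pair_digraph_biclique:
  "finite X \<Longrightarrow> finite Y \<Longrightarrow> X \<inter> Y = {} \<Longrightarrow> pair_digraph (biclique X Y)"
  by unfold_locales auto

lemma degree_biclique:
  "out_degree (with_proj (biclique X Y)) v = (if v \<in> X then card Y else 0)"
  "in_degree (with_proj (biclique X Y)) v = (if v \<in> Y then card X else 0)"
  by (simp_all add: out_degree_with_proj in_degree_with_proj)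

lemma digraph_iso_biclique:
  assumes "finite X" "finite Y" "X \<inter> Y = {}"
  shows "digraph_iso (with_proj (biclique X Y)) (with_proj (oriented_complete_bipartite (card X) (card Y)))"
proof -
  obtain h where h: "bij_betw h X {..<card X}"
    using ex_bij_betw_finite_nat[OF assms(1)] by (auto simp: atLeast0LessThan)
  obtain k where k: "bij_betw k Y {..<card Y}"
    using ex_bij_betw_finite_nat[OF assms(2)] by (auto simp: atLeast0LessThan)
  define f where "f x = (if x \<in> X then Inl (h x) else Inr (k x))" for x
  \<comment> \<open>In \<open>app_iso\<close> the fields \<open>iso_head\<close> and
    \<open>iso_tail\<close> become the head and tail functions of the image, hence the
    projections.\<close>
  define hom where "hom = \<lparr> iso_verts = f, iso_arcs = map_prod f f, iso_head = snd, iso_tail = fst \<rparr>"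
  have inj: "inj_on f (X \<union> Y)"
    using h k assms(3) by (auto simp: f_def inj_on_def bij_betw_def)
  have fX: "f ` X = Inl ` {..<card X}"
    using h by (auto simp: f_def bij_betw_def image_image[symmetric])
  have "f ` Y = (\<lambda>y. Inr (k y)) ` Y" using assms(3) by (intro image_cong) (auto simp: f_def)
  then have fY: "f ` Y = Inr ` {..<card Y}"
    using k by (simp add: bij_betw_def image_image[symmetric])
  have wf: "wf_digraph (with_proj (biclique X Y))"
    using pair_digraph_biclique[OF assms] pair_digraph.pair_wf_digraph wf_digraph_wp_iff by blast
  have "inj_on (map_prod f f) (X \<times> Y)"
    using inj by (auto simp: inj_on_def)
  then have "pre_digraph.digraph_isomorphism (with_proj (biclique X Y)) hom"
    using wf inj by (auto simp: pre_digraph.digraph_isomorphism_def hom_def)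
  moreover have "with_proj (oriented_complete_bipartite (card X) (card Y)) = app_iso hom (with_proj (biclique X Y))"
    by (simp add: app_iso_def with_proj_def oriented_complete_bipartite_def hom_def image_Un fX fY
        map_prod_surj_on[OF fX fY] Plus_def)
  ultimately show ?thesis unfolding digraph_iso_def by blast
qed

text \<open>\<open>X\<close> and \<open>Y\<close> are the preimages of the two sides under the
  vertex map. An isomorphism carries a separate arc map; its compatibility with tails and heads,
  together with injectivity on vertices, ties it to the vertex map.\<close>

lemma biclique_if_digraph_iso:
  assumes iso: "digraph_iso (with_proj H) (with_proj (oriented_complete_bipartite n m))"
  obtains X Y where "finite X" "finite Y" "parcs H = X \<times> Y"
proof -
  obtain f where f: "pre_digraph.digraph_isomorphism (with_proj H) f"
    "with_proj (oriented_complete_bipartite n m) = app_iso f (with_proj H)"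
    using iso unfolding digraph_iso_def by blast
  have wf: "pair_wf_digraph H" and inj: "inj_on (iso_verts f) (pverts H)"
    and comm: "\<And>a. a \<in> parcs H \<Longrightarrow> iso_verts f (fst a) = iso_tail f (iso_arcs f a)"
      "\<And>a. a \<in> parcs H \<Longrightarrow> iso_verts f (snd a) = iso_head f (iso_arcs f a)"
    using f(1) by (auto simp: pre_digraph.digraph_isomorphism_def wf_digraph_wp_iff)
  have V: "iso_verts f ` pverts H = {..<n} <+> {..<m}"
    and E: "iso_arcs f ` parcs H = Inl ` {..<n} \<times> Inr ` {..<m}"
    and ht: "iso_tail f = fst" "iso_head f = snd"
    using f(2) by (simp_all add: app_iso_def with_proj_def oriented_complete_bipartite_def)
  define X where "X = {x \<in> pverts H. iso_verts f x \<in> Inl ` {..<n}}"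
  define Y where "Y = {y \<in> pverts H. iso_verts f y \<in> Inr ` {..<m}}"
  have "finite (pverts H)" using V inj by (metis finite_Plus finite_imageD finite_lessThan)
  then have "finite X" "finite Y" by (simp_all add: X_def Y_def)
  moreover have "parcs H = X \<times> Y"
  proof (intro equalityI subsetI)
    fix a assume a: "a \<in> parcs H"
    then have "iso_arcs f a \<in> Inl ` {..<n} \<times> Inr ` {..<m}" using E by blast
    then have "iso_verts f (fst a) \<in> Inl ` {..<n}" "iso_verts f (snd a) \<in> Inr ` {..<m}"
      using comm[OF a] ht by auto
    then show "a \<in> X \<times> Y"
      using a wf by (auto simp: X_def Y_def mem_Times_iff
          pair_wf_digraph.arc_fst_in_verts pair_wf_digraph.arc_snd_in_verts)
  next
    fix a assume "a \<in> X \<times> Y"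
    then have a: "fst a \<in> pverts H" "snd a \<in> pverts H"
      and "(iso_verts f (fst a), iso_verts f (snd a)) \<in> Inl ` {..<n} \<times> Inr ` {..<m}"
      by (auto simp: X_def Y_def)
    then obtain b where b: "b \<in> parcs H" "iso_arcs f b = (iso_verts f (fst a), iso_verts f (snd a))"
      unfolding E[symmetric] by (elim imageE) simp
    then have "iso_verts f (fst b) = iso_verts f (fst a)" "iso_verts f (snd b) = iso_verts f (snd a)"
      using comm[OF b(1)] ht by auto
    then have "b = a"
      using inj a b(1) wf by (auto simp: inj_on_def prod_eq_iff
          pair_wf_digraph.arc_fst_in_verts pair_wf_digraph.arc_snd_in_verts)
    with b show "a \<in> parcs H" by simp
  qed
  ultimately show thesis by (rule that)
qed

text \<open>Let the piece through \<open>(v, w)\<close> have arc set \<open>X \<times> Y\<close>.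
  There \<open>v\<close> has nonzero out-degree and \<open>w\<close> nonzero in-degree, so the
  degree conditions make \<open>Y\<close> all out-neighbors of \<open>v\<close> and \<open>X\<close>
  all in-neighbors of \<open>w\<close> in \<open>G\<close>. Hence \<open>u\<close> lies in
  \<open>X\<close> and \<open>w'\<close> in \<open>Y\<close>.\<close>

lemma difunctional_if_biclique_splitting:
  assumes G: "pair_digraph G" and split: "sink_source_splitting G Hs"
    and bic: "\<And>H. H \<in> Hs \<Longrightarrow> \<exists>n m. digraph_iso (with_proj H) (with_proj (oriented_complete_bipartite n m))"
  shows "difunctional (parcs G)"
  unfolding difunctional_def
proof (intro allI impI)
  interpret pair_digraph G by (rule G)
  fix v w u w' assume E: "(v, w) \<in> parcs G" "(u, w) \<in> parcs G" "(v, w') \<in> parcs G"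
  obtain H where H: "H \<in> Hs" "(v, w) \<in> parcs H"
    using E split by (auto simp: sink_source_splitting_def)
  obtain X Y where XY: "finite X" "finite Y" "parcs H = X \<times> Y"
    using bic[OF H(1)] biclique_if_digraph_iso by metis
  have sub: "parcs H \<subseteq> parcs G" using split H by (auto simp: sink_source_splitting_def)
  have "pair_wf_digraph H"
    using split H by (auto simp: sink_source_splitting_def sink_source_digraph_def intro: pair_digraph.pair_wf_digraph)
  then have vw: "v \<in> pverts H" "w \<in> pverts H"
    using H(2) pair_wf_digraph.in_arcsD1 pair_wf_digraph.in_arcsD2 by metis+
  have "out_degree (with_proj H) v \<noteq> 0 \<longrightarrow> out_degree (with_proj G) v = out_degree (with_proj H) v"
    "in_degree (with_proj H) w \<noteq> 0 \<longrightarrow> in_degree (with_proj G) w = in_degree (with_proj H) w"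
    using split H(1) vw unfolding sink_source_splitting_def by blast+
  moreover have X: "{x. (x, w) \<in> parcs H} = X" and Y: "{y. (v, y) \<in> parcs H} = Y"
    using H(2) XY(3) by auto
  moreover have "card X \<noteq> 0" "card Y \<noteq> 0" using H(2) XY by auto
  ultimately have deg: "card {y. (v, y) \<in> parcs G} = card Y" "card {x. (x, w) \<in> parcs G} = card X"
    by (simp_all add: out_degree_with_proj in_degree_with_proj)
  have "Y = {y. (v, y) \<in> parcs G}"
    by (rule card_subset_eq) (use sub Y deg finite_neighbours in auto)
  moreover have "X = {x. (x, w) \<in> parcs G}"
    by (rule card_subset_eq) (use sub X deg finite_neighbours in auto)
  ultimately have "(u, w') \<in> X \<times> Y" using E by blast
  then show "(u, w') \<in> parcs G" using sub XY by blast
qed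

text \<open>Each arc \<open>(v, w)\<close> yields the piece with sides \<open>inn w\<close> and
  \<open>out v\<close>. Difunctionality makes their product a set of arcs and gives all vertices on
  one side the same neighborhood in \<open>G\<close>, which is the degree condition.\<close>

lemma biclique_splitting_if_difunctional:
  assumes G: "pair_digraph G" and dif: "difunctional (parcs G)"
  shows "\<exists>Hs. sink_source_splitting G Hs \<and>
    (\<forall>H \<in> Hs. \<exists>n m. digraph_iso (with_proj H) (with_proj (oriented_complete_bipartite n m)))"
proof -
  interpret pair_digraph G by (rule G)
  let ?E = "parcs G"
  define out where "out v = {w. (v, w) \<in> ?E}" for v
  define inn where "inn w = {v. (v, w) \<in> ?E}" for w
  \<comment> \<open>The one-vertex pieces only serve to cover isolated vertices.\<close>
  define Hs where "Hs = (\<lambda>(v, w). biclique (inn w) (out v)) ` ?E \<union> (\<lambda>v. biclique {v} {}) ` pverts G"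
  have fin: "finite (out v)" "finite (inn v)" for v
    unfolding out_def inn_def by (rule finite_neighbours)+
  have sub: "inn w \<times> out v \<subseteq> ?E" if "(v, w) \<in> ?E" for v w
    using dif that unfolding difunctional_def inn_def out_def by blast
  \<comment> \<open>The guards \<open>Y \<noteq> {}\<close> and \<open>X \<noteq> {}\<close> admit
    one-vertex pieces: there the degrees within the piece are 0, while the vertex may have neighbors
    in \<open>G\<close>.\<close>
  define good where "good X Y \<longleftrightarrow> finite X \<and> finite Y \<and> X \<inter> Y = {} \<and> X \<times> Y \<subseteq> ?E \<and> X \<union> Y \<subseteq> pverts G
      \<and> (\<forall>x\<in>X. Y \<noteq> {} \<longrightarrow> out x = Y) \<and> (\<forall>y\<in>Y. X \<noteq> {} \<longrightarrow> inn y = X)" for X Y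
  have good_arc: "good (inn w) (out v)" if vw: "(v, w) \<in> ?E" for v w
  proof -
    \<comment> \<open>A vertex on both sides would carry a loop, since the product of the sides
      consists of arcs.\<close>
    have "inn w \<inter> out v = {}" using sub[OF vw] no_loops' by blast
    moreover have "inn w \<union> out v \<subseteq> pverts G"
      unfolding inn_def out_def using in_arcsD1 in_arcsD2 by blast
    moreover have "\<forall>x\<in>inn w. out x = out v"
      using dif vw unfolding difunctional_def inn_def out_def by blast
    moreover have "\<forall>y\<in>out v. inn y = inn w"
      using dif vw unfolding difunctional_def inn_def out_def by blast
    ultimately show ?thesis using sub[OF vw] fin by (simp add: good_def)
  qed
  have good_vertex: "good {v} {}" if "v \<in> pverts G" for v
    using that by (simp add: good_def)
  have Hs: "\<exists>X Y. H = biclique X Y \<and> good X Y" if "H \<in> Hs" for H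
    using that good_arc good_vertex unfolding Hs_def by fast
  have sub_G: "pverts H \<subseteq> pverts G" "parcs H \<subseteq> ?E" if H: "H \<in> Hs" for H
  proof -
    obtain X Y where "H = biclique X Y" "good X Y" using Hs[OF H] by blast
    then show "pverts H \<subseteq> pverts G" "parcs H \<subseteq> ?E" by (simp_all add: good_def)
  qed
  have "sink_source_splitting G Hs"
    unfolding sink_source_splitting_def
  proof (intro conjI ballI)
    show "finite Hs" using pair_finite_verts pair_finite_arcs by (simp add: Hs_def)
    show "pverts G = (\<Union>H\<in>Hs. pverts H)"
    proof
      show "pverts G \<subseteq> (\<Union>H\<in>Hs. pverts H)" by (auto simp: Hs_def)
      show "(\<Union>H\<in>Hs. pverts H) \<subseteq> pverts G"
        using sub_G by blast
    qed
    show "?E = (\<Union>H\<in>Hs. parcs H)"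
    proof
      show "?E \<subseteq> (\<Union>H\<in>Hs. parcs H)"
      proof
        fix e assume e: "e \<in> ?E"
        obtain v w where vw: "e = (v, w)" by fastforce
        have "biclique (inn w) (out v) \<in> Hs" using e unfolding Hs_def vw by auto
        moreover have "e \<in> parcs (biclique (inn w) (out v))"
          using e by (simp add: vw inn_def out_def)
        ultimately show "e \<in> (\<Union>H\<in>Hs. parcs H)" by blast
      qed
      show "(\<Union>H\<in>Hs. parcs H) \<subseteq> ?E"
        using sub_G by blast
    qed
    fix H assume "H \<in> Hs"
    then obtain X Y where XY: "H = biclique X Y" "finite X" "finite Y" "X \<inter> Y = {}"
      "\<And>x. x \<in> X \<Longrightarrow> Y \<noteq> {} \<Longrightarrow> out x = Y" "\<And>y. y \<in> Y \<Longrightarrow> X \<noteq> {} \<Longrightarrow> inn y = X"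
      using Hs unfolding good_def by metis
    show "sink_source_digraph H"
      using XY(4) pair_digraph_biclique[OF XY(2-4)]
      by (auto simp: XY(1) sink_source_digraph_def is_sink_def is_source_def degree_biclique)
    fix v assume "v \<in> pverts H"
    show "out_degree (with_proj H) v \<noteq> 0 \<longrightarrow> out_degree (with_proj G) v = out_degree (with_proj H) v"
    proof
      assume deg: "out_degree (with_proj H) v \<noteq> 0"
      then have "v \<in> X" "Y \<noteq> {}" by (auto simp: XY(1) degree_biclique split: if_splits)
      then have "out v = Y" by (rule XY(5))
      with \<open>v \<in> X\<close> show "out_degree (with_proj G) v = out_degree (with_proj H) v"
        unfolding XY(1) degree_biclique unfolding out_degree_with_proj out_def by simp
    qed
    show "in_degree (with_proj H) v \<noteq> 0 \<longrightarrow> in_degree (with_proj G) v = in_degree (with_proj H) v"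
    proof
      assume deg: "in_degree (with_proj H) v \<noteq> 0"
      then have "v \<in> Y" "X \<noteq> {}" by (auto simp: XY(1) degree_biclique split: if_splits)
      then have "inn v = X" by (rule XY(6))
      with \<open>v \<in> Y\<close> show "in_degree (with_proj G) v = in_degree (with_proj H) v"
        unfolding XY(1) degree_biclique unfolding in_degree_with_proj inn_def by simp
    qed
  qed
  moreover have "\<exists>n m. digraph_iso (with_proj H) (with_proj (oriented_complete_bipartite n m))"
    if H: "H \<in> Hs" for H
  proof -
    obtain X Y where "H = biclique X Y" "finite X" "finite Y" "X \<inter> Y = {}"
      using Hs[OF H] unfolding good_def by metis
    then show ?thesis using digraph_iso_biclique by metis
  qed
  ultimately show ?thesis by blast
qed

theorem theorem16:
  fixes G :: "'a pair_pre_digraph" and vs :: "'a list"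
  assumes "pair_digraph G"
    and "distinct vs" and "set vs = pverts G"
  shows "energy vs G = 2 * randic_index G \<longleftrightarrow>
    (\<exists>Hs. sink_source_splitting G Hs \<and>
      (\<forall>H \<in> Hs. \<exists>n m. digraph_iso (with_proj H) (with_proj (oriented_complete_bipartite n m))))"
  unfolding energy_eq_two_randic_iff_difunctional[OF assms]
  using difunctional_if_biclique_splitting[OF assms(1)] biclique_splitting_if_difunctional[OF assms(1)]
  by blast

end
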